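(* (a) For $w\in\Omega^n$, there exists a sequence $s$ with $\mathrm{BWT}(s)=w$ if and only if $\mathrm{EBWT}^{-1}(w)$ has the form $(t)^d$ with $t$ primitive and $d\ge 0$ (namely $d=|w|/|t|$); in this case $\mathrm{BWT}(t^d)=w$, and the sequences $s$ with $\mathrm{BWT}(s)=w$ are $t^d$ and its rotations. (b) Let $a_1,\ldots,a_r\in\Omega$ and $d\ge 1$. There exists $s_1$ with $\mathrm{BWT}(s_1)=a_1a_2\cdots a_r$ if and only if there exists $s_2$ with $\mathrm{BWT}(s_2)=a_1^{\,d}a_2^{\,d}\cdots a_r^{\,d}$; when these exist, $s_2$ equals $s_1^{\,d}$ up to a cyclic rotation.
   Context: $\Omega$ is a totally ordered alphabet; $a^d$ for a letter $a$ is $d$ copies of $a$; for a sequence $s$, $s^i$ is $i$ concatenated copies and $\rho(a_1\ldots a_n)=a_na_1\ldots a_{n-1}$. A sequence is primitive if nonempty and not a power $u^e$ with $e>1$. Burrows–Wheeler Transform: for $s\in\Omega^n$, sort the $n$ rotations $\rho^0(s),\ldots,\rho^{n-1}(s)$ (with repetitions) lexicographically as rows of an $n\times n$ table; $\mathrm{BWT}(s)$ is the last column read top to bottom (BWT of the empty word is empty). A multicyclic sequence is a finite multiset of aperiodic cycles $(s_1)\cdots(s_r)$ ($s_i$ primitive, cycles up to rotation); $(t)^d$ is $d$ copies of the cycle $(t)$; $\mathcal{M}_n$ is the set of multicyclic sequences of total length $n$. Extended Burrows–Wheeler Transform: for $\sigma=(s_1)\cdots(s_r)\in\mathcal{M}_n$,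 let $c=\mathrm{lcm}(|s_1|,\ldots,|s_r|)$; for each cycle (with multiplicity) and each $j=0,\ldots,|s_i|-1$ form the row $(\rho^j(s_i))^{c/|s_i|}$; sort the $n$ rows lexicographically; $\mathrm{EBWT}(\sigma)\in\Omega^n$ is the last column read top to bottom. It is known (Mantaci et al.) that $\mathrm{EBWT}:\mathcal{M}_n\to\Omega^n$ is a bijection; $\mathrm{EBWT}^{-1}$ denotes its inverse. *)

theory Defs
  imports "HOL-Library.Multiset" "HOL-Library.List_Lexorder"
begin

text \<open>
  The totally ordered alphabet is a type of class \<open>linorder\<close>; sequences are lists, compared
  lexicographically through the \<open>linorder\<close> instance from \<open>List_Lexorder\<close>.
\<close>

definition wpow :: "'a list \<Rightarrow> nat \<Rightarrow> 'a list" where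
  "wpow s i = concat (replicate i s)"

text \<open>The rotation moves the last letter to the front, unlike \<open>rotate1\<close>.\<close>

definition rho :: "'a list \<Rightarrow> 'a list" where
  "rho s = (if s = [] then [] else last s # butlast s)"

definition primitive :: "'a list \<Rightarrow> bool" where
  "primitive s \<longleftrightarrow> s \<noteq> [] \<and> \<not> (\<exists>u e. e > 1 \<and> s = wpow u e)"

definition BWT :: "'a::linorder list \<Rightarrow> 'a list" where
  "BWT s = map last (sort (map (\<lambda>j. (rho ^^ j) s) [0..<length s]))"

text \<open>A cycle \<open>(s)\<close> is represented by the set of all rotations of \<open>s\<close>.\<close>

definition cycle :: "'a list \<Rightarrow> 'a list set" where
  "cycle s = {(rho ^^ j) s | j. True}"

text \<open>
  A cycle is accessed through an arbitrary representative. Replacing the representative by one of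
  its rotations changes neither its length nor the multiset of rows below.
\<close>

definition cycle_rep :: "'a list set \<Rightarrow> 'a list" where
  "cycle_rep C = (SOME s. s \<in> C)"

definition cycle_length :: "'a list set \<Rightarrow> nat" where
  "cycle_length C = length (cycle_rep C)"

definition multicyclic :: "nat \<Rightarrow> 'a list set multiset set" where
  "multicyclic n =
    {\<sigma>. (\<forall>C \<in># \<sigma>. \<exists>s. primitive s \<and> C = cycle s) \<and> (\<Sum>C \<in># \<sigma>. cycle_length C) = n}"

definition cycle_rows :: "nat \<Rightarrow> 'a list set \<Rightarrow> 'a list multiset" where
  "cycle_rows c C =
    {# wpow ((rho ^^ j) (cycle_rep C)) (c div cycle_length C). j \<in># mset [0..<cycle_length C] #}"

definition EBWT :: "'a::linorder list set multiset \<Rightarrow> 'a list" where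
  "EBWT \<sigma> =
    (let c = Lcm (cycle_length ` set_mset \<sigma>)
     in map last (sorted_list_of_multiset (\<Sum>C \<in># \<sigma>. cycle_rows c C)))"

text \<open>The inverse of the bijection \<open>EBWT\<close> from \<open>multicyclic n\<close> to the words of length \<open>n\<close>.\<close>

definition EBWT_inv :: "'a::linorder list \<Rightarrow> 'a list set multiset" where
  "EBWT_inv w = inv_into (multicyclic (length w)) EBWT w"

end

theory Submission
  imports Defs "HOL-Library.Product_Lexorder" "HOL-Combinatorics.Permutations"
begin

text \<open>
  A multicyclic sequence is the same thing as a rotation-invariant multiset \<open>P\<close> of primitive words,
  and \<open>EBWT\<close> reads off the last column of the sorted table with rows \<open>u\<^bsup>N/|u|\<^esup>\<close> for \<open>u \<in> P\<close>,
  where \<open>N\<close> may be any common multiple of the lengths.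

  Injectivity: the rows form a rotation-invariant multiset, so prepending the last column to the
  table of the first \<open>k\<close> columns and sorting gives the first \<open>k + 1\<close> columns. Hence the last column
  determines the table, and the primitive roots of its rows give back \<open>P\<close>.

  Surjectivity: let \<open>\<pi>\<close> be the permutation that sorts \<open>w\<close> stably and \<open>\<pi>\<^sup>N = id\<close>. The rows
  \<open>w(\<pi> i), w(\<pi>\<^sup>2 i), \<dots>, w(\<pi>\<^sup>N i)\<close> increase with \<open>i\<close>, are permuted by rotation, and have last
  column \<open>w\<close>; take \<open>P\<close> to be the multiset of their primitive roots.

  Part (a) then follows from \<open>BWT (t\<^sup>e) = EBWT ((t)\<^sup>e)\<close>. For part (b), repeating every cycle \<open>d\<close> times
  repeats every letter of the transform \<open>d\<close> times, so by injectivity the preimage of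
  \<open>a\<^sub>1\<^sup>d\<dots>a\<^sub>r\<^sup>d\<close> is \<open>d\<close> times the preimage of \<open>a\<^sub>1\<dots>a\<^sub>r\<close>, and one is a power of a single
  cycle if and only if the other is.
\<close>

section \<open>Powers, rotations and primitive roots\<close>

lemma wpow_0 [simp]: "wpow s 0 = []"
  and wpow_Suc [simp]: "wpow s (Suc n) = s @ wpow s n"
  by (simp_all add: wpow_def)

lemma wpow_1 [simp]: "wpow s (Suc 0) = s"
  by simp

lemma wpow_Nil [simp]: "wpow [] n = []"
  by (induction n) auto

lemma wpow_add: "wpow s (m + n) = wpow s m @ wpow s n"
  by (induction m) auto

lemma wpow_mult: "wpow s (m * n) = wpow (wpow s m) n"
  by (induction n) (auto simp: wpow_add)

lemma length_wpow [simp]: "length (wpow s n) = n * length s"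
  by (induction n) auto

lemma last_wpow: "s \<noteq> [] \<Longrightarrow> n > 0 \<Longrightarrow> last (wpow s n) = last s"
proof (induction n)
  case (Suc n)
  then show ?case by (cases n) auto
qed simp

lemma nth_wpow: "k < n * length s \<Longrightarrow> wpow s n ! k = s ! (k mod length s)"
proof (induction n arbitrary: k)
  case (Suc n)
  then show ?case
    by (cases "k < length s") (auto simp: nth_append le_mod_geq)
qed simp

lemma rho_Nil [simp]: "rho [] = []"
  by (simp add: rho_def)

lemma rho_snoc [simp]: "rho (xs @ [x]) = x # xs"
  by (simp add: rho_def)

lemma length_rho [simp]: "length (rho s) = length s"
  by (simp add: rho_def)

lemma rho_eq_Nil_iff [simp]: "rho s = [] \<longleftrightarrow> s = []"
  by (simp add: rho_def)

lemma rotate1_rho [simp]: "rotate1 (rho s) = s"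
  by (cases s rule: rev_cases) auto

lemma rho_rotate1 [simp]: "rho (rotate1 s) = s"
  by (cases s) auto

lemma inj_rho: "inj rho"
  by (metis injI rotate1_rho)

lemma length_funpow_rho [simp]: "length ((rho ^^ j) s) = length s"
  by (induction j) auto

lemma rotate_funpow_rho: "rotate j ((rho ^^ j) s) = s"
  by (induction j arbitrary: s) (auto simp: rotate_def funpow_swap1)

lemma funpow_rho_rotate: "(rho ^^ j) (rotate j s) = s"
  by (induction j arbitrary: s) (auto simp: rotate_def funpow_swap1)

lemma funpow_rho_length [simp]: "(rho ^^ length s) s = s"
  using funpow_rho_rotate[of "length s" s] by simp

lemma funpow_rho_mod: "(rho ^^ (j mod length s)) s = (rho ^^ j) s"
  by (rule funpow_mod_eq) simp

lemma wpow_Cons_snoc: "wpow (x # xs) n @ [x] = x # wpow (xs @ [x]) n"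
  by (induction n) auto

lemma wpow_commute: "s @ wpow s n = wpow s n @ s"
  by (induction n) auto

text \<open>With \<open>s = xs x\<close>, the letter \<open>x\<close> moved to the front opens a
  block \<open>x xs\<close>, and each remaining \<open>x\<close> joins the copy of \<open>xs\<close>
  after it.\<close>

lemma rho_wpow: "rho (wpow s n) = wpow (rho s) n"
proof (cases s rule: rev_cases)
  case (snoc xs x)
  show ?thesis
  proof (cases n)
    case (Suc m)
    have "wpow s n = (wpow s m @ xs) @ [x]"
      using Suc snoc wpow_commute[of s m] by simp
    then have "rho (wpow s n) = x # wpow s m @ xs"
      using rho_snoc[of "wpow s m @ xs" x] by simp
    also have "\<dots> = wpow (x # xs) m @ x # xs"
      using wpow_Cons_snoc[of x xs m] snoc by (metis append.assoc append_Cons append_Nil)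
    also have "\<dots> = wpow (rho s) n"
      using Suc snoc by (simp add: wpow_commute[of "x # xs", simplified])
    finally show ?thesis .
  qed simp
qed simp

lemma funpow_rho_wpow: "(rho ^^ j) (wpow s n) = wpow ((rho ^^ j) s) n"
  by (induction j) (auto simp: rho_wpow)

section \<open>Primitive words and primitive roots\<close>

lemma primitive_not_Nil: "primitive s \<Longrightarrow> s \<noteq> []"
  by (simp add: primitive_def)

lemma primitive_wpowD: "primitive s \<Longrightarrow> s = wpow u e \<Longrightarrow> e = 1"
  unfolding primitive_def by (metis less_one nat_neq_iff wpow_0)

lemma primitive_singleton: "primitive [x]"
proof -
  have "e \<le> 1" if "[x] = wpow u e" for u e
    using arg_cong[OF that, of length] by simp
  then show ?thesis
    unfolding primitive_def by (metis leD list.distinct(1))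
qed

lemma primitive_rho:
  assumes "primitive s"
  shows "primitive (rho s)"
proof -
  have "\<not> e > 1" if "rho s = wpow u e" for u e
  proof -
    have "rho s = rho (wpow (rotate1 u) e)"
      using that by (simp add: rho_wpow)
    then have "s = wpow (rotate1 u) e"
      by (metis rotate1_rho)
    with assms show ?thesis
      using primitive_wpowD by fastforce
  qed
  with assms show ?thesis
    by (auto simp: primitive_def)
qed

lemma primitive_funpow_rho: "primitive s \<Longrightarrow> primitive ((rho ^^ j) s)"
  by (induction j) (auto simp: primitive_rho)

lemma primitive_root_exists: "\<exists>t e. primitive t \<and> s = wpow t e"
proof (induction "length s" arbitrary: s rule: less_induct)
  case less
  show ?case
  proof (cases "s = [] \<or> primitive s")
    case True
    then show ?thesis
      by (metis primitive_singleton wpow_0 wpow_1)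
  next
    case False
    then obtain u e where ue: "e > 1" "s = wpow u e" "s \<noteq> []"
      by (auto simp: primitive_def)
    then have "u \<noteq> []" by auto
    with ue have "length u < length s" by simp
    from less[OF this] ue show ?thesis
      by (metis wpow_mult)
  qed
qed

text \<open>Two words with a common nonempty power commute, and commuting words are powers of one
  word; primitivity makes both exponents 1.\<close>

lemma primitive_root_unique:
  assumes "primitive p" "primitive q" and eq: "wpow p e = wpow q f" and "e > 0"
  shows "p = q"
proof -
  \<comment> \<open>The periodic infinite extension of the common power. Both
    \<open>length p\<close> and \<open>length q\<close> divide the length of that power, so both are
    periods of \<open>x\<close>.\<close>
  define x where "x = (\<lambda>k. wpow p e ! (k mod length (wpow p e)))"
  have ne: "p \<noteq> []" "q \<noteq> []"
    using assms by (simp_all add: primitive_not_Nil)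
  with \<open>e > 0\<close> have len: "length (wpow p e) > 0" by simp
  with eq have "f > 0" by (cases f) auto
  have xp: "x k = p ! (k mod length p)" for k
    unfolding x_def using len by (subst nth_wpow) (auto simp: mod_mod_cancel)
  have xq: "x k = q ! (k mod length q)" for k
    unfolding x_def using len unfolding eq by (subst nth_wpow) (auto simp: mod_mod_cancel)
  have 1: "(p @ q) ! k = x k" if "k < length p + length q" for k
  proof (cases "k < length p")
    case False
    then have "q ! (k - length p) = x (k - length p)"
      using that by (simp add: xq)
    with False show ?thesis
      by (simp add: nth_append xp le_mod_geq)
  qed (simp add: nth_append xp)
  have 2: "(q @ p) ! k = x k" if "k < length p + length q" for k
  proof (cases "k < length q")
    case False
    then have "p ! (k - length q) = x (k - length q)"
      using that by (simp add: xp)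
    with False show ?thesis
      by (simp add: nth_append xq le_mod_geq)
  qed (simp add: nth_append xq)
  \<comment> \<open>Both products are the prefix of length \<open>|p| + |q|\<close> of the periodic word \<open>x\<close>.\<close>
  have "p @ q = q @ p"
    by (rule nth_equalityI) (simp_all add: 1 2)
  then obtain m n zs where "wpow zs m = p" "wpow zs n = q"
    unfolding wpow_def using comm_append_are_replicate by blast
  with assms show ?thesis
    by (metis primitive_wpowD)
qed

text \<open>For the empty word this picks some primitive word, with exponent 0. It keeps the
  function total, but compatibility with \<open>rho\<close> can then be claimed only for nonempty
  words.\<close>

definition primitive_root :: "'a list \<Rightarrow> 'a list" where
  "primitive_root s = (SOME t. primitive t \<and> (\<exists>e. s = wpow t e))"

lemma primitive_root:
  shows primitive_primitive_root: "primitive (primitive_root s)"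
    and wpow_primitive_root: "s = wpow (primitive_root s) (length s div length (primitive_root s))"
proof -
  have *: "primitive (primitive_root s) \<and> (\<exists>e. s = wpow (primitive_root s) e)"
    unfolding primitive_root_def by (rule someI_ex) (use primitive_root_exists in blast)
  then show p: "primitive (primitive_root s)" by blast
  from * obtain e where e: "s = wpow (primitive_root s) e" by blast
  then have "length s = e * length (primitive_root s)"
    by (metis length_wpow)
  then have "e = length s div length (primitive_root s)"
    using primitive_not_Nil[OF p] by simp
  with e show "s = wpow (primitive_root s) (length s div length (primitive_root s))"
    by simp
qed

lemma length_primitive_root_dvd: "length (primitive_root s) dvd length s"
  by (metis wpow_primitive_root length_wpow dvd_triv_right)

lemma primitive_root_wpow:
  assumes "primitive p" "e > 0"
  shows "primitive_root (wpow p e) = p"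
  using primitive_root_unique[OF assms(1) primitive_primitive_root wpow_primitive_root assms(2)]
  by simp

lemma primitive_root_rho:
  assumes "s \<noteq> []"
  shows "primitive_root (rho s) = rho (primitive_root s)"
proof -
  let ?e = "length s div length (primitive_root s)"
  have s: "s = wpow (primitive_root s) ?e"
    by (rule wpow_primitive_root)
  with assms have "?e > 0"
    by (metis gr0I wpow_0)
  moreover have "rho s = wpow (rho (primitive_root s)) ?e"
    by (metis s rho_wpow)
  ultimately show ?thesis
    by (metis primitive_root_wpow primitive_rho primitive_primitive_root)
qed

section \<open>Aperiodic cycles as rotation-invariant multisets\<close>

text \<open>Two equal rotations would make \<open>s\<close> invariant under rotation by some
  \<open>k\<close> with \<open>0 < k < length s\<close>. The prefix of length \<open>k\<close> would
  then commute with the rest, and \<open>s\<close> would be a proper power.\<close>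

lemma inj_on_rho_primitive:
  assumes "primitive s"
  shows "inj_on (\<lambda>j. (rho ^^ j) s) {..<length s}"
proof -
  have False if "(rho ^^ i) s = (rho ^^ j) s" "i < j" "j < length s" for i j
  proof -
    define k where "k = j - i"
    have k: "0 < k" "k < length s" "j = i + k"
      using that by (auto simp: k_def)
    have "(rho ^^ i) ((rho ^^ k) s) = (rho ^^ i) s"
      using that k by (simp add: funpow_add)
    then have "(rho ^^ k) s = s"
      by (metis rotate_funpow_rho)
    then have "rotate k s = s"
      by (metis rotate_funpow_rho)
    then have "drop k s @ take k s = take k s @ drop k s"
      using k by (simp add: rotate_drop_take)
    then obtain m n zs where mn: "wpow zs m = drop k s" "wpow zs n = take k s"
      unfolding wpow_def using comm_append_are_replicate by blast
    have "s = wpow zs (n + m)"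
      by (simp add: wpow_add mn)
    moreover have "m \<noteq> 0" "n \<noteq> 0"
      using mn k by (auto intro!: Nat.gr0I)
    ultimately show False
      using primitive_wpowD[OF assms] by fastforce
  qed
  then show ?thesis
    by (auto simp: inj_on_def) (metis linorder_neqE_nat)
qed

lemma cycle_conv_image:
  assumes "s \<noteq> []"
  shows "cycle s = (\<lambda>j. (rho ^^ j) s) ` {..<length s}"
proof
  show "cycle s \<subseteq> (\<lambda>j. (rho ^^ j) s) ` {..<length s}"
  proof
    fix u assume "u \<in> cycle s"
    then obtain j where "u = (rho ^^ j) s" by (auto simp: cycle_def)
    then have "u = (rho ^^ (j mod length s)) s" by (simp add: funpow_rho_mod)
    with assms show "u \<in> (\<lambda>j. (rho ^^ j) s) ` {..<length s}" by auto
  qed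
qed (auto simp: cycle_def)

lemma finite_cycle [simp]: "finite (cycle s)"
proof (cases "s = []")
  case True
  have "(rho ^^ j) [] = []" for j
    by (induction j) auto
  then have "cycle s = {[]}" using True by (auto simp: cycle_def)
  then show ?thesis by simp
qed (simp add: cycle_conv_image)

lemma self_in_cycle [simp]: "s \<in> cycle s"
  by (auto simp: cycle_def intro: exI[of _ 0])

lemma cycle_subset: "u \<in> cycle s \<Longrightarrow> cycle u \<subseteq> cycle s"
  unfolding cycle_def by (force simp: funpow_add[unfolded comp_def, THEN fun_cong, symmetric])

lemma cycle_sym:
  assumes "u \<in> cycle s"
  shows "s \<in> cycle u"
proof (cases "s = []")
  case False
  with assms obtain j where j: "j < length s" "u = (rho ^^ j) s"
    by (auto simp: cycle_conv_image)
  then have "(rho ^^ (length s - j)) u = (rho ^^ (length s - j + j)) s"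
    by (simp only: funpow_add comp_apply)
  with j have "(rho ^^ (length s - j)) u = s" by simp
  then show ?thesis unfolding cycle_def by (metis (mono_tags, lifting) mem_Collect_eq)
next
  case True
  obtain j where "u = (rho ^^ j) s" using assms by (auto simp: cycle_def)
  then have "length u = length s" by simp
  with True show ?thesis by simp
qed

lemma cycle_eq: "u \<in> cycle s \<Longrightarrow> cycle u = cycle s"
  by (meson cycle_subset cycle_sym subset_antisym)

lemma rho_image_cycle: "rho ` cycle s = cycle s"
proof
  show "rho ` cycle s \<subseteq> cycle s"
  proof
    fix u assume "u \<in> rho ` cycle s"
    then obtain j where "u = (rho ^^ Suc j) s" by (auto simp: cycle_def)
    then show "u \<in> cycle s" unfolding cycle_def by blast
  qed
  then show "cycle s \<subseteq> rho ` cycle s"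
    using card_subset_eq[OF finite_cycle, of "rho ` cycle s" s] card_image[OF inj_on_subset[OF inj_rho]]
    by (metis subset_UNIV subset_refl)
qed

text \<open>The rotations of a primitive word are pairwise distinct, so the set of rotations loses
  no multiplicity against the family of rows indexed by \<open>j\<close>.\<close>

lemma mset_set_cycle:
  assumes "primitive s"
  shows "mset_set (cycle s) = image_mset (\<lambda>j. (rho ^^ j) s) (mset [0..<length s])"
  using assms inj_on_rho_primitive[OF assms]
  by (simp add: cycle_conv_image primitive_not_Nil image_mset_mset_set lessThan_atLeast0)

definition aperiodic_cycle :: "'a list set \<Rightarrow> bool" where
  "aperiodic_cycle C \<longleftrightarrow> (\<exists>s. primitive s \<and> C = cycle s)"

lemma aperiodic_cycle_cycle: "primitive s \<Longrightarrow> aperiodic_cycle (cycle s)"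
  by (auto simp: aperiodic_cycle_def)

lemma aperiodic_cycleD:
  assumes "aperiodic_cycle C" "u \<in> C"
  shows "primitive u" "C = cycle u" "length u = cycle_length C"
proof -
  from assms obtain s where s: "primitive s" "C = cycle s"
    by (auto simp: aperiodic_cycle_def)
  have *: "primitive v \<and> length v = length s" if "v \<in> C" for v
    using that s primitive_funpow_rho by (auto simp: cycle_def)
  show "primitive u" "C = cycle u"
    using * assms s by (auto simp: cycle_eq)
  have "cycle_rep C \<in> C"
    unfolding cycle_rep_def by (rule someI) fact
  then show "length u = cycle_length C"
    using * assms by (simp add: cycle_length_def)
qed

lemma cycle_rep_in:
  assumes "aperiodic_cycle C"
  shows "cycle_rep C \<in> C"
  using assms unfolding aperiodic_cycle_def cycle_rep_def by (metis self_in_cycle someI)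

lemma cycle_length_cycle: "primitive s \<Longrightarrow> cycle_length (cycle s) = length s"
  using aperiodic_cycleD(3)[OF aperiodic_cycle_cycle self_in_cycle] by metis

lemma finite_aperiodic_cycle: "aperiodic_cycle C \<Longrightarrow> finite C"
  by (auto simp: aperiodic_cycle_def)

lemma cycle_length_pos: "aperiodic_cycle C \<Longrightarrow> cycle_length C > 0"
  using aperiodic_cycleD(1)[OF _ cycle_rep_in] primitive_not_Nil
  by (fastforce simp: cycle_length_def)

lemma Lcm_cycle_length_pos:
  assumes "finite A" "\<And>C. C \<in> A \<Longrightarrow> aperiodic_cycle C"
  shows "Lcm (cycle_length ` A) > 0"
proof -
  have "0 \<notin> cycle_length ` A"
    using assms(2) cycle_length_pos by fastforce
  then show ?thesis
    using assms(1) Lcm_0_iff[of "cycle_length ` A"] by (simp add: neq0_conv[symmetric] del: neq0_conv)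
qed

section \<open>Tables of rows and the words on the cycles\<close>

lemma image_mset_idI: "(\<And>x. x \<in># M \<Longrightarrow> f x = x) \<Longrightarrow> image_mset f M = M"
  by (induction M) auto

text \<open>The unsorted table of the extended transform. The width \<open>N\<close> is free,
  instead of being the least common multiple, so that two multicyclic sequences can share one
  width.\<close>

definition power_rows :: "nat \<Rightarrow> 'a list multiset \<Rightarrow> 'a list multiset" where
  "power_rows N P = image_mset (\<lambda>u. wpow u (N div length u)) P"

definition last_column :: "'a::linorder list multiset \<Rightarrow> 'a list" where
  "last_column M = map last (sorted_list_of_multiset M)"

definition cycle_words :: "'a list set multiset \<Rightarrow> 'a list multiset" where
  "cycle_words \<sigma> = (\<Sum>C\<in>#\<sigma>. mset_set C)"

lemma cycle_rows_conv:
  assumes "aperiodic_cycle C"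
  shows "cycle_rows c C = power_rows c (mset_set C)"
proof -
  note C = aperiodic_cycleD[OF assms cycle_rep_in[OF assms]]
  have "mset_set C = image_mset (\<lambda>j. (rho ^^ j) (cycle_rep C)) (mset [0..<length (cycle_rep C)])"
    by (subst C(2)) (rule mset_set_cycle[OF C(1)])
  then show ?thesis
    by (simp add: cycle_rows_def power_rows_def C(3) image_mset.compositionality comp_def
        del: mset_upt)
qed

lemma cycle_words_empty [simp]: "cycle_words {#} = {#}"
  and cycle_words_add_mset [simp]: "cycle_words (add_mset C \<sigma>) = mset_set C + cycle_words \<sigma>"
  by (simp_all add: cycle_words_def)

lemma sum_cycle_rows:
  "\<forall>C\<in>#\<sigma>. aperiodic_cycle C \<Longrightarrow> (\<Sum>C\<in>#\<sigma>. cycle_rows c C) = power_rows c (cycle_words \<sigma>)"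
  by (induction \<sigma>) (auto simp: cycle_rows_conv power_rows_def)

lemma size_cycle_words:
  "\<forall>C\<in>#\<sigma>. aperiodic_cycle C \<Longrightarrow> size (cycle_words \<sigma>) = (\<Sum>C\<in>#\<sigma>. cycle_length C)"
proof (induction \<sigma>)
  case (add C \<sigma>)
  then obtain s where s: "primitive s" "C = cycle s" by (auto simp: aperiodic_cycle_def)
  then have "size (mset_set C) = length s"
    by (simp add: mset_set_cycle del: mset_upt size_mset_set)
  with s add show ?case by (simp add: cycle_length_cycle)
qed simp

text \<open>Distinct cycles are disjoint, so \<open>u\<close> occurs only in the copies of its own
  cycle. The multiplicities of the cycles can thus be read off from the words.\<close>

lemma count_cycle_words:
  assumes "\<forall>C\<in>#\<sigma>. aperiodic_cycle C"
  shows "count (cycle_words \<sigma>) u = count \<sigma> (cycle u)"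
  using assms
proof (induction \<sigma>)
  case (add C \<sigma>)
  then have "aperiodic_cycle C" by simp
  then have "u \<in> C \<longleftrightarrow> C = cycle u"
    by (metis aperiodic_cycleD(2) self_in_cycle)
  then have "count (mset_set C) u = (if C = cycle u then 1 else 0)"
    using finite_aperiodic_cycle[OF \<open>aperiodic_cycle C\<close>] by (simp add: count_mset_set')
  with add show ?case by simp
qed simp

lemma set_cycle_words:
  "\<forall>C\<in>#\<sigma>. aperiodic_cycle C \<Longrightarrow> set_mset (cycle_words \<sigma>) = \<Union>(set_mset \<sigma>)"
  by (induction \<sigma>) (auto simp: finite_aperiodic_cycle)

lemma cycle_words_inj:
  assumes "\<forall>C\<in>#\<sigma>. aperiodic_cycle C" "\<forall>C\<in>#\<tau>. aperiodic_cycle C" "cycle_words \<sigma> = cycle_words \<tau>"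
  shows "\<sigma> = \<tau>"
proof (rule multiset_eqI)
  fix C
  show "count \<sigma> C = count \<tau> C"
  proof (cases "aperiodic_cycle C")
    case True
    then obtain s where "C = cycle s" by (auto simp: aperiodic_cycle_def)
    then show ?thesis
      using assms count_cycle_words by metis
  next
    case False
    with assms show ?thesis by (metis count_inI)
  qed
qed

lemma image_rho_cycle_words:
  "\<forall>C\<in>#\<sigma>. aperiodic_cycle C \<Longrightarrow> image_mset rho (cycle_words \<sigma>) = cycle_words \<sigma>"
proof (induction \<sigma>)
  case (add C \<sigma>)
  then obtain s where "C = cycle s" by (auto simp: aperiodic_cycle_def)
  then have "image_mset rho (mset_set C) = mset_set C"
    by (simp add: image_mset_mset_set[OF inj_on_subset[OF inj_rho]] rho_image_cycle)
  with add show ?case by simp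
qed simp

text \<open>Invariance puts the whole cycle of any member \<open>s\<close> into \<open>P\<close>.
  Removing one copy of that cycle leaves a smaller invariant multiset, to which induction
  applies.\<close>

lemma cycle_words_surj:
  assumes "image_mset rho P = P" "\<forall>u\<in>#P. primitive u"
  shows "\<exists>\<sigma>. (\<forall>C\<in>#\<sigma>. aperiodic_cycle C) \<and> cycle_words \<sigma> = P"
  using assms
proof (induction "size P" arbitrary: P rule: less_induct)
  case less
  show ?case
  proof (cases "P = {#}")
    case True
    then show ?thesis by (auto intro: exI[of _ "{#}"])
  next
    case False
    then obtain s where s: "s \<in># P" by auto
    have "(rho ^^ j) s \<in># P" for j
    proof (induction j)
      case (Suc j)
      then have "rho ((rho ^^ j) s) \<in># image_mset rho P" by auto
      with less.prems show ?case by simp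
    qed (simp add: s)
    then have sub: "cycle s \<subseteq> set_mset P" by (auto simp: cycle_def)
    then have "mset_set (cycle s) \<subseteq># P"
      by (auto simp: subseteq_mset_def count_mset_set' Suc_le_eq)
    then obtain Q where Q: "P = mset_set (cycle s) + Q"
      by (metis subset_mset.le_iff_add)
    have "image_mset rho (mset_set (cycle s)) = mset_set (cycle s)"
      by (simp add: image_mset_mset_set[OF inj_on_subset[OF inj_rho]] rho_image_cycle)
    with less.prems Q have "image_mset rho Q = Q" by simp
    moreover have "size Q < size P"
      using Q by (auto simp: card_gt_0_iff intro: self_in_cycle)
    moreover have "\<forall>u\<in>#Q. primitive u" using less.prems Q by auto
    ultimately obtain \<sigma> where "\<forall>C\<in>#\<sigma>. aperiodic_cycle C" "cycle_words \<sigma> = Q"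
      using less.hyps by blast
    moreover have "aperiodic_cycle (cycle s)"
      using s less.prems aperiodic_cycle_cycle by blast
    ultimately show ?thesis
      using Q by (intro exI[of _ "add_mset (cycle s) \<sigma>"]) auto
  qed
qed

section \<open>Last columns of sorted tables\<close>

text \<open>Equal lengths rule out that \<open>u\<close> is a proper prefix of \<open>v\<close>, so
  the comparison is decided by a differing letter inside \<open>u\<close> and
  \<open>v\<close>.\<close>

lemma append_less_append_eq_length:
  fixes u v :: "'a::linorder list"
  assumes "length u = length v" "u < v"
  shows "u @ x < v @ y"
  using assms unfolding list_less_def by (simp add: lexord_sufI)

lemma wpow_mono:
  fixes u v :: "'a::linorder list"
  assumes "length u = length v" "u \<le> v"
  shows "wpow u n \<le> wpow v n"
proof (cases "u = v \<or> n = 0")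
  case False
  then obtain m where "n = Suc m" "u < v" using assms by (cases n) auto
  then show ?thesis
    using append_less_append_eq_length[OF assms(1)] by (simp add: order.strict_implies_order)
qed auto

lemma take_mono:
  fixes u v :: "'a::linorder list"
  assumes "u \<le> v"
  shows "take k u \<le> take k v"
  using assms
proof (induction k arbitrary: u v)
  case (Suc k)
  then show ?case by (cases u; cases v) auto
qed simp

lemma sorted_list_of_multiset_image_mono:
  assumes "\<And>x y. x \<in># M \<Longrightarrow> y \<in># M \<Longrightarrow> x \<le> y \<Longrightarrow> f x \<le> f y"
  shows "sorted_list_of_multiset (image_mset f M) = map f (sorted_list_of_multiset M)"
proof -
  have "sorted (map f (sorted_list_of_multiset M))"
    unfolding sorted_map
    by (rule sorted_wrt_mono_rel[OF _ sorted_sorted_list_of_multiset]) (use assms in auto)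
  then have "sort (map f (sorted_list_of_multiset M)) = map f (sorted_list_of_multiset M)"
    by (rule sort_key_id_if_sorted[where f = "\<lambda>x. x", unfolded list.map_ident])
  then show ?thesis
    by (metis mset_map mset_sorted_list_of_multiset sorted_list_of_multiset_mset)
qed

text \<open>Repeating rows of equal length keeps both their order and their last letters. This makes
  the width of the table irrelevant.\<close>

lemma last_column_image_wpow:
  fixes M :: "'a::linorder list multiset"
  assumes "\<forall>r\<in>#M. length r = N" "N > 0" "k > 0"
  shows "last_column (image_mset (\<lambda>r. wpow r k) M) = last_column M"
proof -
  have "sorted_list_of_multiset (image_mset (\<lambda>r. wpow r k) M)
    = map (\<lambda>r. wpow r k) (sorted_list_of_multiset M)"
    using assms by (intro sorted_list_of_multiset_image_mono wpow_mono) auto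
  moreover have "last (wpow r k) = last r" if "r \<in># M" for r
    using that assms by (intro last_wpow) auto
  ultimately show ?thesis by (simp add: last_column_def)
qed

lemma power_rows_length:
  assumes "\<forall>u\<in>#P. length u dvd N" "r \<in># power_rows N P"
  shows "length r = N"
  using assms by (auto simp: power_rows_def)

lemma last_column_power_rows:
  assumes "\<forall>u\<in>#P. length u dvd c" "c dvd N" "N > 0"
  shows "last_column (power_rows N P) = last_column (power_rows c P)"
proof -
  obtain k where k: "N = c * k" using assms by blast
  with assms have pos: "c > 0" "k > 0" by auto
  have "wpow u (N div length u) = wpow (wpow u (c div length u)) k" if "u \<in># P" for u
  proof -
    have "N div length u = c div length u * k"
      using that assms k by (simp add: div_mult_swap mult.commute)
    then show ?thesis by (simp add: wpow_mult)
  qed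
  then have "power_rows N P = image_mset (\<lambda>r. wpow r k) (power_rows c P)"
    by (auto simp: power_rows_def image_mset.compositionality comp_def intro!: image_mset_cong)
  then show ?thesis
    using last_column_image_wpow[OF _ pos] power_rows_length[OF assms(1)] by metis
qed

lemma image_rho_power_rows:
  assumes "image_mset rho P = P"
  shows "image_mset rho (power_rows N P) = power_rows N P"
proof -
  have "image_mset rho (power_rows N P) = power_rows N (image_mset rho P)"
    by (simp add: power_rows_def image_mset.compositionality comp_def rho_wpow)
  with assms show ?thesis by simp
qed

text \<open>Passing from the least common multiple to a positive common multiple \<open>N\<close>
  only repeats every row a fixed number of times.\<close>

lemma EBWT_conv:
  assumes "\<forall>C\<in>#\<sigma>. aperiodic_cycle C" "\<forall>C\<in>#\<sigma>. cycle_length C dvd N" "N > 0"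
  shows "EBWT \<sigma> = last_column (power_rows N (cycle_words \<sigma>))"
proof -
  let ?c = "Lcm (cycle_length ` set_mset \<sigma>)"
  have "EBWT \<sigma> = last_column (power_rows ?c (cycle_words \<sigma>))"
    using sum_cycle_rows[OF assms(1)] by (simp add: EBWT_def last_column_def)
  also have "\<dots> = last_column (power_rows N (cycle_words \<sigma>))"
  proof (rule last_column_power_rows[symmetric])
    show "\<forall>u\<in>#cycle_words \<sigma>. length u dvd ?c"
    proof
      fix u assume "u \<in># cycle_words \<sigma>"
      then obtain C where "C \<in># \<sigma>" "u \<in> C" using set_cycle_words[OF assms(1)] by auto
      then have "length u = cycle_length C" "cycle_length C \<in> cycle_length ` set_mset \<sigma>"
        using assms(1) aperiodic_cycleD(3) by auto
      then show "length u dvd ?c" by simp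
    qed
    show "?c dvd N" using assms(2) by (auto intro: Lcm_least)
  qed fact
  finally show ?thesis .
qed

section \<open>Injectivity of the extended transform\<close>

text \<open>Rotation permutes the rows and moves the last letter of each to the front, so the
  right-hand list holds all prefixes of length \<open>k + 1\<close>. Truncation is monotone, so
  sorting them gives the prefixes of the sorted rows.\<close>

lemma take_Suc_sorted_rows:
  fixes M :: "'a::linorder list multiset"
  assumes "\<forall>r\<in>#M. length r = N" "image_mset rho M = M" "k < N"
  shows "map (take (Suc k)) (sorted_list_of_multiset M)
    = sort (map2 (#) (last_column M) (map (take k) (sorted_list_of_multiset M)))"
proof -
  let ?R = "sorted_list_of_multiset M"
  have "map2 (#) (last_column M) (map (take k) ?R) = map (\<lambda>r. last r # take k r) ?R"
    by (simp add: last_column_def zip_map_map zip_same_conv_map)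
  also have "\<dots> = map (take (Suc k) \<circ> rho) ?R"
  proof (rule map_cong)
    fix r assume "r \<in> set ?R"
    then have "length r = N" using assms by simp
    with assms(3) show "last r # take k r = (take (Suc k) \<circ> rho) r"
      by (cases r rule: rev_cases) auto
  qed simp
  finally have "mset (map2 (#) (last_column M) (map (take k) ?R))
      = image_mset (take (Suc k)) (image_mset rho M)"
    by (simp add: image_mset.compositionality)
  then have "sort (map2 (#) (last_column M) (map (take k) ?R))
      = sorted_list_of_multiset (image_mset (take (Suc k)) M)"
    using assms(2) by (metis sorted_list_of_multiset_mset)
  also have "\<dots> = map (take (Suc k)) ?R"
    by (intro sorted_list_of_multiset_image_mono take_mono)
  finally show ?thesis by simp
qed

lemma last_column_inj:
  fixes M M' :: "'a::linorder list multiset"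
  assumes "\<forall>r\<in>#M. length r = N" "image_mset rho M = M"
    and "\<forall>r\<in>#M'. length r = N" "image_mset rho M' = M'"
    and eq: "last_column M = last_column M'"
  shows "M = M'"
proof -
  have "map (take k) (sorted_list_of_multiset M) = map (take k) (sorted_list_of_multiset M')"
    if "k \<le> N" for k
    using that
  proof (induction k)
    \<comment> \<open>Empty prefixes carry only the number of rows, which is the length of the last
      column.\<close>
    case 0
    have "size M = size M'"
      using arg_cong[OF eq, of length] by (simp add: last_column_def)
        (metis mset_sorted_list_of_multiset size_mset)
    then have "length (sorted_list_of_multiset M) = length (sorted_list_of_multiset M')"
      by (metis mset_sorted_list_of_multiset size_mset)
    then show ?case by (simp add: map_replicate_const)
  next
    case (Suc k)
    then show ?case
      using take_Suc_sorted_rows[OF assms(1,2), of k] take_Suc_sorted_rows[OF assms(3,4), of k] eq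
      by simp
  qed
  from this[of N] have "map (take N) (sorted_list_of_multiset M)
      = map (take N) (sorted_list_of_multiset M')" by simp
  moreover have "map (take N) (sorted_list_of_multiset M) = sorted_list_of_multiset M"
    using assms(1) by (intro map_idI) simp
  moreover have "map (take N) (sorted_list_of_multiset M') = sorted_list_of_multiset M'"
    using assms(3) by (intro map_idI) simp
  ultimately show ?thesis
    by (metis mset_sorted_list_of_multiset)
qed

lemma EBWT_inj:
  assumes "\<forall>C\<in>#\<sigma>. aperiodic_cycle C" "\<forall>C\<in>#\<tau>. aperiodic_cycle C" "EBWT \<sigma> = EBWT \<tau>"
  shows "\<sigma> = \<tau>"
proof -
  define N where "N = Lcm (cycle_length ` (set_mset \<sigma> \<union> set_mset \<tau>))"
  have dvd: "\<forall>C\<in>#\<sigma>. cycle_length C dvd N" "\<forall>C\<in>#\<tau>. cycle_length C dvd N"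
    by (auto simp: N_def)
  have pos: "N > 0"
    unfolding N_def using assms(1,2) by (intro Lcm_cycle_length_pos) auto
  \<comment> \<open>Here \<open>\<rho>\<close> is a multicyclic sequence, to be instantiated with
    \<open>\<sigma>\<close> and with \<open>\<tau>\<close>; it is unrelated to the rotation
    \<open>rho\<close>.\<close>
  have root: "image_mset primitive_root (power_rows N (cycle_words \<rho>)) = cycle_words \<rho>"
    and len: "\<forall>r\<in>#power_rows N (cycle_words \<rho>). length r = N"
    and rot: "image_mset rho (power_rows N (cycle_words \<rho>)) = power_rows N (cycle_words \<rho>)"
    if \<rho>: "\<forall>C\<in>#\<rho>. aperiodic_cycle C" "\<forall>C\<in>#\<rho>. cycle_length C dvd N" for \<rho> :: "'a list set multiset"
  proof -
    have u: "primitive u" "length u dvd N" if u: "u \<in># cycle_words \<rho>" for u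
    proof -
      obtain C where C: "C \<in># \<rho>" "u \<in> C"
        using u set_cycle_words[OF \<rho>(1)] by auto
      with \<rho> have "aperiodic_cycle C" "cycle_length C dvd N" by auto
      with C(2) show "primitive u" "length u dvd N"
        using aperiodic_cycleD(1,3)[of C u] by simp_all
    qed
    then have "primitive_root (wpow u (N div length u)) = u" if "u \<in># cycle_words \<rho>" for u
      using that pos
      by (intro primitive_root_wpow)
        (auto simp: div_greater_zero_iff dvd_imp_le primitive_not_Nil)
    then show "image_mset primitive_root (power_rows N (cycle_words \<rho>)) = cycle_words \<rho>"
      by (simp add: power_rows_def image_mset.compositionality comp_def image_mset_idI)
    show "\<forall>r\<in>#power_rows N (cycle_words \<rho>). length r = N"
      using power_rows_length u by blast
    show "image_mset rho (power_rows N (cycle_words \<rho>)) = power_rows N (cycle_words \<rho>)"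
      by (intro image_rho_power_rows image_rho_cycle_words \<rho>)
  qed
  have "power_rows N (cycle_words \<sigma>) = power_rows N (cycle_words \<tau>)"
  proof (rule last_column_inj[where N = N])
    show "last_column (power_rows N (cycle_words \<sigma>)) = last_column (power_rows N (cycle_words \<tau>))"
      using assms dvd pos by (metis EBWT_conv)
  qed (fact len[OF assms(1) dvd(1)] rot[OF assms(1) dvd(1)]
      len[OF assms(2) dvd(2)] rot[OF assms(2) dvd(2)])+
  from arg_cong[OF this, of "image_mset primitive_root"]
  have "cycle_words \<sigma> = cycle_words \<tau>"
    by (simp only: root[OF assms(1) dvd(1)] root[OF assms(2) dvd(2)])
  with assms(1,2) show ?thesis by (rule cycle_words_inj)
qed

section \<open>Surjectivity of the extended transform\<close>

text \<open>Sorting the pairs of letter and position lexicographically is a stable sort of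
  \<open>w\<close>; the second components give \<open>\<pi>\<close>.\<close>

lemma standard_permutation_exists:
  fixes w :: "'a::linorder list"
  shows "\<exists>\<pi>. \<pi> permutes {..<length w} \<and>
    (\<forall>i j. i < j \<longrightarrow> j < length w \<longrightarrow>
      w ! \<pi> i < w ! \<pi> j \<or> w ! \<pi> i = w ! \<pi> j \<and> \<pi> i < \<pi> j)"
proof -
  define n where "n = length w"
  define S where "S = (\<lambda>i. (w ! i, i)) ` {..<n}"
  define L where "L = sorted_list_of_set S"
  \<comment> \<open>The value \<open>i\<close> beyond the word is what \<open>permutes\<close>
    demands outside the set.\<close>
  define \<pi> where "\<pi> i = (if i < n then snd (L ! i) else i)" for i
  have "inj_on (\<lambda>i. (w ! i, i)) {..<n}"
    by (auto simp: inj_on_def)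
  then have len: "length L = n"
    by (simp add: L_def S_def card_image)
  have set: "set L = S"
    by (simp add: L_def S_def)
  have nth: "L ! i = (w ! \<pi> i, \<pi> i)" "\<pi> i < n" if "i < n" for i
  proof -
    have "L ! i \<in> S" using that len set nth_mem by metis
    then show "L ! i = (w ! \<pi> i, \<pi> i)" "\<pi> i < n"
      using that by (auto simp: S_def \<pi>_def)
  qed
  have less: "L ! i < L ! j" if "i < j" "j < n" for i j
    using that len strict_sorted_list_of_set[of S]
    by (simp add: L_def sorted_wrt_nth_less)
  have "inj_on \<pi> {..<n}"
  proof (rule inj_onI)
    fix i j assume ij: "i \<in> {..<n}" "j \<in> {..<n}" "\<pi> i = \<pi> j"
    then have "L ! i = L ! j" by (simp add: nth)
    moreover have "distinct L" by (simp add: L_def)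
    ultimately show "i = j" using ij len by (simp add: nth_eq_iff_index_eq)
  qed
  moreover have "\<pi> ` {..<n} \<subseteq> {..<n}" using nth by auto
  ultimately have "bij_betw \<pi> {..<n} {..<n}"
    by (simp add: bij_betw_def endo_inj_surj)
  then have "\<pi> permutes {..<n}"
    by (rule bij_imp_permutes) (simp add: \<pi>_def)
  moreover have "w ! \<pi> i < w ! \<pi> j \<or> w ! \<pi> i = w ! \<pi> j \<and> \<pi> i < \<pi> j"
    if "i < j" "j < n" for i j
    using less[OF that] nth(1)[of i] nth(1)[of j] that by auto
  ultimately show ?thesis
    unfolding n_def by blast
qed

text \<open>A finite set has finitely many permutations, so two powers of \<open>p\<close> coincide;
  the smaller one is injective and cancels.\<close>

lemma permutes_funpow_eq_id:
  assumes "p permutes S" "finite S"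
  shows "\<exists>N>0. p ^^ N = id"
proof -
  have "p ^^ k permutes S" for k
    by (induction k) (auto simp only: funpow.simps permutes_id permutes_compose assms(1))
  then have "range (\<lambda>k. p ^^ k) \<subseteq> {q. q permutes S}" by auto
  then have "finite (range (\<lambda>k. p ^^ k))"
    using finite_permutations[OF assms(2)] finite_subset by blast
  then have "\<not> inj (\<lambda>k. p ^^ k)"
    using finite_imageD infinite_UNIV_nat by blast
  then obtain i j where ij: "i < j" "p ^^ i = p ^^ j"
    unfolding inj_def by (metis linorder_neqE_nat)
  have "p ^^ i \<circ> p ^^ (j - i) = p ^^ (i + (j - i))"
    by (rule funpow_add[symmetric])
  also have "\<dots> = p ^^ i \<circ> id"
    using ij by simp
  finally have "p ^^ i \<circ> p ^^ (j - i) = p ^^ i \<circ> id" .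
  moreover have "inj (p ^^ i)"
    using assms(1) by (simp add: inj_fn permutes_inj)
  ultimately have "p ^^ (j - i) = id"
    by (metis fun.inj_map injD)
  with ij show ?thesis by (meson zero_less_diff)
qed

lemma last_column_surj:
  fixes w :: "'a::linorder list"
  shows "\<exists>M N. N > 0 \<and> (\<forall>r\<in>#M. length r = N) \<and> image_mset rho M = M \<and> last_column M = w"
proof -
  define n where "n = length w"
  obtain \<pi> where perm: "\<pi> permutes {..<n}"
    and less: "\<And>i j. i < j \<Longrightarrow> j < n \<Longrightarrow>
      w ! \<pi> i < w ! \<pi> j \<or> w ! \<pi> i = w ! \<pi> j \<and> \<pi> i < \<pi> j"
    using standard_permutation_exists[of w] unfolding n_def by blast
  obtain N where N: "\<pi> ^^ N = id" "N > 0"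
    using permutes_funpow_eq_id[OF perm] by auto
  \<comment> \<open>The exponents run from 1 to \<open>K\<close>, not from 0, so that for
    \<open>K = N\<close> the last letter is \<open>w ! i\<close>, because
    \<open>\<pi> ^^ N = id\<close>.\<close>
  define row where "row K i = map (\<lambda>k. w ! (\<pi> ^^ Suc k) i) [0..<K]" for K i
  define M where "M = image_mset (row N) (mset_set {..<n})"
  have row_Suc: "row (Suc K) i = w ! \<pi> i # row K (\<pi> i)" for K i
    unfolding row_def by (simp add: upt_conv_Cons map_Suc_upt[symmetric] funpow_swap1 del: upt_Suc)
  have row_Suc': "row (Suc K) i = row K i @ [w ! (\<pi> ^^ Suc K) i]" for K i
    by (simp add: row_def)
  obtain K where K: "N = Suc K" using N by (cases N) auto
  have last_row: "last (row N i) = w ! i" for i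
    using N by (simp only: K row_Suc') simp
  \<comment> \<open>The row of \<open>\<pi> i\<close> is the row of \<open>i\<close> shifted by one
    step, and its last letter \<open>w ! \<pi> i\<close> is the first letter of the row of
    \<open>i\<close>.\<close>
  have rho_row: "rho (row N (\<pi> i)) = row N i" for i
  proof -
    have "(\<pi> ^^ Suc K) (\<pi> i) = \<pi> i" using N K by simp
    then have "row N (\<pi> i) = row K (\<pi> i) @ [w ! \<pi> i]" by (simp only: K row_Suc')
    then show ?thesis by (simp add: K row_Suc)
  qed
  have "image_mset \<pi> (mset_set {..<n}) = mset_set {..<n}"
    using perm by (rule permutes_image_mset)
  then have "M = image_mset (row N) (image_mset \<pi> (mset_set {..<n}))"
    by (simp add: M_def)
  then have "image_mset rho M = M"
    by (simp add: M_def image_mset.compositionality comp_def rho_row)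
  moreover have "\<forall>r\<in>#M. length r = N"
    by (auto simp: M_def row_def)
  moreover have "last_column M = w"
  proof -
    \<comment> \<open>Induction on the width, since removing the first letter passes from
      \<open>i\<close> to \<open>\<pi> i\<close>. On equal first letters, stability gives
      \<open>\<pi> i < \<pi> j\<close> and the shorter rows decide.\<close>
    have mono: "row K i \<le> row K j" if "i \<le> j" "j < n" for K i j
      using that
    proof (induction K arbitrary: i j)
      case 0
      then show ?case by (simp add: row_def)
    next
      case (Suc K)
      show ?case
      proof (cases "i = j")
        case False
        moreover have "\<pi> j < n" using Suc.prems permutes_in_image[OF perm] by simp
        ultimately show ?thesis
          using less[of i j] Suc by (auto simp: row_Suc)
      qed simp
    qed
    have "sorted_list_of_multiset M = map (row N) (sorted_list_of_multiset (mset_set {..<n}))"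
      unfolding M_def by (rule sorted_list_of_multiset_image_mono) (auto intro: mono)
    also have "sorted_list_of_multiset (mset_set {..<n}) = [0..<n]"
      by (simp add: lessThan_atLeast0)
    finally show ?thesis
      by (simp add: last_column_def comp_def last_row n_def map_nth)
  qed
  ultimately show ?thesis using N by blast
qed

text \<open>Replacing rows by their primitive roots loses nothing: each row has length
  \<open>N\<close> and is recovered as the power of its root that has this length.\<close>

lemma EBWT_surj:
  fixes w :: "'a::linorder list"
  shows "\<exists>\<sigma>. (\<forall>C\<in>#\<sigma>. aperiodic_cycle C) \<and> EBWT \<sigma> = w"
proof -
  obtain M N where N: "N > 0" and len: "\<forall>r\<in>#M. length r = N"
    and rot: "image_mset rho M = M" and w: "last_column M = w"
    using last_column_surj by blast
  define P where "P = image_mset primitive_root M"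
  have "image_mset rho P = image_mset primitive_root (image_mset rho M)"
    unfolding P_def image_mset.compositionality using len N
    by (intro image_mset_cong) (auto intro!: primitive_root_rho[symmetric])
  then have "image_mset rho P = P" by (simp add: rot P_def)
  moreover have "\<forall>u\<in>#P. primitive u"
    by (auto simp: P_def primitive_primitive_root)
  ultimately obtain \<sigma> where \<sigma>: "\<forall>C\<in>#\<sigma>. aperiodic_cycle C" "cycle_words \<sigma> = P"
    using cycle_words_surj by blast
  have "cycle_length C dvd N" if "C \<in># \<sigma>" for C
  proof -
    have C: "aperiodic_cycle C" using \<sigma> that by blast
    then have "cycle_rep C \<in># P"
      using \<sigma> that cycle_rep_in set_cycle_words by blast
    then show ?thesis
      using len by (auto simp: P_def cycle_length_def) (metis length_primitive_root_dvd)
  qed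
  then have "EBWT \<sigma> = last_column (power_rows N P)"
    using EBWT_conv \<sigma> N by metis
  also have "power_rows N P = M"
  proof -
    have "wpow (primitive_root r) (N div length (primitive_root r)) = r" if "r \<in># M" for r
      using that len wpow_primitive_root by metis
    then show ?thesis
      by (simp add: P_def power_rows_def image_mset.compositionality comp_def image_mset_idI)
  qed
  finally show ?thesis using \<sigma> w by blast
qed

section \<open>The inverse of the extended transform\<close>

lemma length_last_column [simp]: "length (last_column M) = size M"
  by (metis last_column_def length_map mset_sorted_list_of_multiset size_mset)

lemma multicyclic_iff:
  "\<sigma> \<in> multicyclic n \<longleftrightarrow> (\<forall>C\<in>#\<sigma>. aperiodic_cycle C) \<and> n = length (EBWT \<sigma>)"
proof -
  have "length (EBWT \<sigma>) = (\<Sum>C\<in>#\<sigma>. cycle_length C)" if "\<forall>C\<in>#\<sigma>. aperiodic_cycle C"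
  proof -
    have "length (EBWT \<sigma>) = size (\<Sum>C\<in>#\<sigma>. cycle_rows (Lcm (cycle_length ` set_mset \<sigma>)) C)"
      by (simp add: EBWT_def flip: last_column_def)
    also have "\<dots> = size (cycle_words \<sigma>)"
      using that by (simp add: sum_cycle_rows power_rows_def)
    finally show ?thesis using that by (simp add: size_cycle_words)
  qed
  then show ?thesis by (auto simp: multicyclic_def aperiodic_cycle_def)
qed

text \<open>Bijectivity turns every claim about \<open>EBWT_inv\<close> into one about
  \<open>EBWT\<close>, with no reference to a fixed total length.\<close>

lemma EBWT_inv_eq_iff:
  assumes "\<forall>C\<in>#\<sigma>. aperiodic_cycle C"
  shows "EBWT_inv w = \<sigma> \<longleftrightarrow> EBWT \<sigma> = w"
proof -
  obtain \<tau> where \<tau>: "\<forall>C\<in>#\<tau>. aperiodic_cycle C" "EBWT \<tau> = w"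
    using EBWT_surj by blast
  then have "\<tau> \<in> multicyclic (length w)" by (simp add: multicyclic_iff)
  moreover have "inj_on EBWT (multicyclic (length w))"
    by (rule inj_onI) (auto simp: multicyclic_iff intro: EBWT_inj)
  ultimately have "EBWT_inv w = \<tau>"
    unfolding EBWT_inv_def using \<tau> by (metis inv_into_f_f)
  then show ?thesis using \<tau> assms EBWT_inj by blast
qed

section \<open>The ordinary transform\<close>

lemma BWT_conv: "BWT s = last_column (image_mset (\<lambda>j. (rho ^^ j) s) (mset [0..<length s]))"
  unfolding BWT_def last_column_def by (metis mset_map sorted_list_of_multiset_mset)

lemma image_mset_upt_periodic:
  assumes "\<And>k. f (k + n) = f k"
  shows "image_mset f (mset [0..<d * n]) = repeat_mset d (image_mset f (mset [0..<n]))"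
proof (induction d)
  case (Suc d)
  have shift: "f (k + d * n) = f k" for k
    by (induction d) (auto simp: assms add.assoc[symmetric] add.commute[of n])
  have "[0..<Suc d * n] = [0..<d * n] @ map (\<lambda>k. k + d * n) [0..<n]"
    using upt_add_eq_append[of 0 "d * n" n] by (simp add: map_add_upt add.commute)
  then have "mset [0..<Suc d * n] = mset [0..<d * n] + image_mset (\<lambda>k. k + d * n) (mset [0..<n])"
    by (metis mset_append mset_map)
  then show ?case
    using Suc by (simp add: image_mset.compositionality comp_def shift del: mset_upt)
qed simp

text \<open>Rotation commutes with powers, and \<open>j\<close> runs through \<open>d\<close> full
  periods of the rotations of \<open>s\<close>, so each row is met \<open>d\<close> times as
  often.\<close>

lemma rotations_wpow:
  "image_mset (\<lambda>j. (rho ^^ j) (wpow s d)) (mset [0..<length (wpow s d)])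
    = repeat_mset d (image_mset (\<lambda>u. wpow u d) (image_mset (\<lambda>j. (rho ^^ j) s) (mset [0..<length s])))"
proof -
  have "(rho ^^ (k + length s)) s = (rho ^^ k) s" for k
    by (simp add: funpow_add)
  then show ?thesis
    unfolding length_wpow by (subst image_mset_upt_periodic)
      (simp_all add: funpow_rho_wpow image_mset.compositionality comp_def del: mset_upt)
qed

lemma sorted_list_of_repeat_mset:
  "sorted_list_of_multiset (repeat_mset d M) = concat (map (replicate d) (sorted_list_of_multiset M))"
proof -
  let ?L = "concat (map (replicate d) (sorted_list_of_multiset M))"
  have sorted: "sorted (concat (map (replicate d) xs))" if "sorted xs" for xs :: "'a list"
    using that by (induction xs) (auto simp: sorted_append sorted_replicate)
  have mset: "mset (concat (map (replicate d) xs)) = repeat_mset d (mset xs)" for xs :: "'a list"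
    by (induction xs) (auto simp: repeat_mset_distrib)
  have "sort ?L = ?L"
    using sorted[of "sorted_list_of_multiset M"] by (simp add: sorted_sort_id)
  then show ?thesis
    using mset[of "sorted_list_of_multiset M"]
    by (metis mset_sorted_list_of_multiset sorted_list_of_multiset_mset)
qed

lemma last_column_repeat_mset:
  "last_column (repeat_mset d M) = concat (map (replicate d) (last_column M))"
  by (simp add: last_column_def sorted_list_of_repeat_mset map_concat comp_def)

text \<open>The table of \<open>s^d\<close> has the rows of the table of \<open>s\<close> raised to
  the power \<open>d\<close>, which keeps the last column, and repeated \<open>d\<close> times,
  which stretches it.\<close>

lemma BWT_wpow:
  assumes "d > 0"
  shows "BWT (wpow s d) = concat (map (replicate d) (BWT s))"
proof (cases "s = []")
  case True
  then show ?thesis by (simp add: BWT_def)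
next
  case False
  then show ?thesis
    using assms unfolding BWT_conv rotations_wpow last_column_repeat_mset
    by (subst last_column_image_wpow[where N = "length s"]) auto
qed

lemma image_mset_repeat_mset: "image_mset f (repeat_mset d M) = repeat_mset d (image_mset f M)"
  by (induction d) auto

lemma cycle_words_repeat_mset: "cycle_words (repeat_mset d \<sigma>) = repeat_mset d (cycle_words \<sigma>)"
  by (induction d) (auto simp: cycle_words_def)

lemma set_mset_repeat_mset: "d > 0 \<Longrightarrow> set_mset (repeat_mset d M) = set_mset M"
  by (simp add: set_eq_iff flip: count_greater_zero_iff)

lemma EBWT_repeat_mset:
  assumes "\<forall>C\<in>#\<sigma>. aperiodic_cycle C" "d > 0"
  shows "EBWT (repeat_mset d \<sigma>) = concat (map (replicate d) (EBWT \<sigma>))"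
proof -
  define N where "N = Lcm (cycle_length ` set_mset \<sigma>)"
  have "N > 0" unfolding N_def using assms(1) by (intro Lcm_cycle_length_pos) auto
  moreover have "\<forall>C\<in>#\<sigma>. cycle_length C dvd N" by (auto simp: N_def)
  moreover have "set_mset (repeat_mset d \<sigma>) = set_mset \<sigma>"
    using assms by (simp add: set_mset_repeat_mset)
  ultimately show ?thesis
    using assms EBWT_conv[of \<sigma> N] EBWT_conv[of "repeat_mset d \<sigma>" N]
    by (simp add: cycle_words_repeat_mset power_rows_def last_column_repeat_mset image_mset_repeat_mset)
qed

text \<open>For exponent 1 both tables consist of the rotations of \<open>t\<close>. A larger
  exponent stretches both transforms in the same way, and exponent 0 gives the empty word on both
  sides.\<close>

lemma BWT_wpow_primitive:
  assumes "primitive t"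
  shows "BWT (wpow t e) = EBWT (replicate_mset e (cycle t))"
proof (cases "e = 0")
  case True
  then show ?thesis by (simp add: BWT_def EBWT_def)
next
  case False
  let ?C = "{#cycle t#}"
  have "EBWT ?C = last_column (power_rows (length t) (mset_set (cycle t)))"
    using assms primitive_not_Nil[OF assms]
    by (subst EBWT_conv[where N = "length t"]) (auto simp: aperiodic_cycle_cycle cycle_length_cycle)
  also have "power_rows (length t) (mset_set (cycle t)) = mset_set (cycle t)"
    using assms primitive_not_Nil[OF assms] unfolding mset_set_cycle[OF assms] power_rows_def
    by (simp add: image_mset.compositionality comp_def del: mset_upt)
  finally have "BWT t = EBWT ?C"
    by (simp add: BWT_conv mset_set_cycle[OF assms] del: mset_upt)
  moreover have "replicate_mset e (cycle t) = repeat_mset e ?C"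
    by (simp add: repeat_mset_replicate_mset)
  ultimately show ?thesis
    using False assms EBWT_repeat_mset[of ?C e] by (simp add: BWT_wpow aperiodic_cycle_cycle)
qed

lemma BWT_rho: "BWT (rho s) = BWT s"
proof -
  let ?f = "\<lambda>j. (rho ^^ j) s"
  \<comment> \<open>Peeling the range \<open>0..length s\<close> at either end compares the two
    tables: the rotations by 0 and by \<open>length s\<close> agree.\<close>
  have "[0..<Suc (length s)] = 0 # map Suc [0..<length s]"
    by (simp add: map_Suc_upt upt_conv_Cons del: upt_Suc)
  then have "image_mset ?f (mset [0..<Suc (length s)])
      = image_mset ?f (mset (0 # map Suc [0..<length s]))"
    by (simp only:)
  then have "add_mset (?f 0) (image_mset (\<lambda>j. ?f (Suc j)) (mset [0..<length s])) =
    image_mset ?f (mset [0..<Suc (length s)])"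
    by (simp add: image_mset.compositionality comp_def del: mset_upt upt_Suc)
  also have "\<dots> = add_mset (?f 0) (image_mset ?f (mset [0..<length s]))"
    by (simp del: mset_upt)
  finally show ?thesis
    by (simp add: BWT_conv funpow_swap1 del: mset_upt)
qed

lemma BWT_funpow_rho: "BWT ((rho ^^ j) s) = BWT s"
  by (induction j) (auto simp: BWT_rho)

section \<open>Fibres of the ordinary transform and stretched words\<close>

lemma BWT_eq_iff:
  assumes "primitive t"
  shows "BWT s = BWT (wpow t e) \<longleftrightarrow> (\<exists>j. s = (rho ^^ j) (wpow t e))"
proof
  assume eq: "BWT s = BWT (wpow t e)"
  obtain u f where u: "primitive u" "s = wpow u f"
    using primitive_root_exists by blast
  have "EBWT (replicate_mset f (cycle u)) = EBWT (replicate_mset e (cycle t))"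
    using eq u assms by (simp add: BWT_wpow_primitive)
  then have "replicate_mset f (cycle u) = replicate_mset e (cycle t)"
    by (rule EBWT_inj[rotated 2]) (auto simp: assms u aperiodic_cycle_cycle in_replicate_mset)
  from arg_cong[OF this, of size] arg_cong[OF this, of set_mset]
  \<comment> \<open>If \<open>e = 0\<close>, both multisets are empty and say nothing about the
    cycles; both words are then empty.\<close>
  have "f = e" "e = 0 \<or> cycle u = cycle t"
    by (simp_all split: if_splits)
  then have "e = 0 \<or> (\<exists>j. u = (rho ^^ j) t)"
    using self_in_cycle[of u] by (auto simp: cycle_def)
  then show "\<exists>j. s = (rho ^^ j) (wpow t e)"
    using u \<open>f = e\<close> by (auto simp: funpow_rho_wpow)
qed (auto simp: BWT_funpow_rho)

lemma BWT_exists_iff_EBWT_inv: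
  "(\<exists>s. BWT s = w) \<longleftrightarrow> (\<exists>t e. primitive t \<and> EBWT_inv w = replicate_mset e (cycle t))"
proof -
  have "EBWT_inv w = replicate_mset e (cycle t) \<longleftrightarrow> BWT (wpow t e) = w" if "primitive t" for t e
    using that
    by (subst EBWT_inv_eq_iff)
      (auto simp: BWT_wpow_primitive aperiodic_cycle_cycle in_replicate_mset)
  then show ?thesis
    by (metis primitive_root_exists)
qed

lemma length_BWT [simp]: "length (BWT s) = length s"
  by (simp add: BWT_def)

lemma BWT_of_EBWT_inv:
  assumes "primitive t" "EBWT_inv w = replicate_mset e (cycle t)"
  shows "BWT (wpow t e) = w" "length w = e * length t"
    "{s. BWT s = w} = {(rho ^^ j) (wpow t e) | j. True}"
proof -
  show w: "BWT (wpow t e) = w"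
    using assms EBWT_inv_eq_iff[of "replicate_mset e (cycle t)" w]
    by (simp add: BWT_wpow_primitive aperiodic_cycle_cycle in_replicate_mset)
  then show "length w = e * length t"
    by (metis length_BWT length_wpow)
  show "{s. BWT s = w} = {(rho ^^ j) (wpow t e) | j. True}"
    using BWT_eq_iff[OF assms(1)] w by auto
qed

text \<open>Let \<open>\<sigma>\<close> be the preimage of \<open>a\<close> under
  \<open>EBWT\<close>. By injectivity its \<open>d\<close>-fold repetition is a multiple of one
  cycle, so \<open>\<sigma>\<close> is supported on that cycle too, and its size is the exponent
  sought.\<close>

lemma BWT_stretch_imp:
  assumes "d > 0" "BWT s = concat (map (replicate d) a)"
  shows "\<exists>s. BWT s = a"
proof -
  obtain \<sigma> where \<sigma>: "\<forall>C\<in>#\<sigma>. aperiodic_cycle C" "EBWT \<sigma> = a"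
    using EBWT_surj by blast
  obtain t e where t: "primitive t" "s = wpow t e"
    using primitive_root_exists by blast
  have "EBWT (repeat_mset d \<sigma>) = EBWT (replicate_mset e (cycle t))"
    using assms \<sigma> t by (simp add: EBWT_repeat_mset BWT_wpow_primitive)
  then have "repeat_mset d \<sigma> = replicate_mset e (cycle t)"
    by (rule EBWT_inj[rotated 2]) (use \<sigma> t assms(1) in \<open>auto simp: aperiodic_cycle_cycle set_mset_repeat_mset\<close>)
  then have "set_mset (repeat_mset d \<sigma>) \<subseteq> {cycle t}"
    by (metis set_mset_replicate_mset_subset empty_subsetI order_refl)
  then have "set_mset \<sigma> \<subseteq> {cycle t}" using assms(1) by (simp add: set_mset_repeat_mset)
  then have "\<sigma> = replicate_mset (size \<sigma>) (cycle t)"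
    by (rule set_mset_subset_singletonD)
  then have "EBWT (replicate_mset (size \<sigma>) (cycle t)) = a"
    using \<sigma>(2) by (rule subst)
  then have "BWT (wpow t (size \<sigma>)) = a"
    by (simp only: BWT_wpow_primitive[OF t(1)])
  then show ?thesis ..
qed

text \<open>The power \<open>s1^d\<close> has the same transform as \<open>s2\<close>, and words
  with equal transforms are rotations of each other.\<close>

lemma BWT_stretch_unique:
  assumes "d > 0" "BWT s1 = a" "BWT s2 = concat (map (replicate d) a)"
  shows "\<exists>j. s2 = (rho ^^ j) (wpow s1 d)"
proof -
  obtain t e where t: "primitive t" "s1 = wpow t e"
    using primitive_root_exists by blast
  then have "wpow s1 d = wpow t (e * d)" by (simp add: wpow_mult)
  moreover have "BWT s2 = BWT (wpow s1 d)" using assms by (simp add: BWT_wpow)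
  ultimately show ?thesis using BWT_eq_iff[OF t(1)] by metis
qed

theorem theorem8:
  fixes w a :: "'a::linorder list" and d :: nat
  shows
    "(((\<exists>s. BWT s = w) \<longleftrightarrow> (\<exists>t e. primitive t \<and> EBWT_inv w = replicate_mset e (cycle t)))
      \<and> (\<forall>t e. primitive t \<and> EBWT_inv w = replicate_mset e (cycle t) \<longrightarrow>
            length t dvd length w \<and> e = length w div length t
            \<and> BWT (wpow t e) = w
            \<and> {s. BWT s = w} = {(rho ^^ j) (wpow t e) | j. True}))
     \<and> (d \<ge> 1 \<longrightarrow>
          ((\<exists>s1. BWT s1 = a) \<longleftrightarrow> (\<exists>s2. BWT s2 = concat (map (replicate d) a)))
          \<and> (\<forall>s1 s2. BWT s1 = a \<and> BWT s2 = concat (map (replicate d) a) \<longrightarrow>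
                (\<exists>j. s2 = (rho ^^ j) (wpow s1 d))))"
proof (intro conjI allI impI)
  show "(\<exists>s. BWT s = w) \<longleftrightarrow> (\<exists>t e. primitive t \<and> EBWT_inv w = replicate_mset e (cycle t))"
    by (rule BWT_exists_iff_EBWT_inv)
next
  fix t e assume "primitive t \<and> EBWT_inv w = replicate_mset e (cycle t)"
  then have t: "primitive t" "EBWT_inv w = replicate_mset e (cycle t)" by auto
  note * = BWT_of_EBWT_inv[OF t]
  show "length t dvd length w" "e = length w div length t"
    using *(2) primitive_not_Nil[OF t(1)] by auto
  show "BWT (wpow t e) = w" "{s. BWT s = w} = {(rho ^^ j) (wpow t e) | j. True}"
    using * by auto
next
  assume "d \<ge> 1"
  then show "(\<exists>s1. BWT s1 = a) \<longleftrightarrow> (\<exists>s2. BWT s2 = concat (map (replicate d) a))"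
    using BWT_wpow BWT_stretch_imp by (metis less_eq_Suc_le One_nat_def)
next
  fix s1 s2 assume "d \<ge> 1" "BWT s1 = a \<and> BWT s2 = concat (map (replicate d) a)"
  then show "\<exists>j. s2 = (rho ^^ j) (wpow s1 d)"
    using BWT_stretch_unique[of d s1 a s2] by simp
qed

end
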